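(* Let $Q$ be an IPC formula and $\theta = (Z_N, \dots, Z_0)$ a finite sequence of IPC formulas, each of the form $QW$ or $QQW$ for some IPC formula $W$. Suppose some term of $\theta$ is a formula $\beta = QQ(X \supset Y)$ for IPC formulas $X, Y$, and put $\beta_0 = QX$, $\beta_1 = QQY$. If both $\mathcal{D}(\beta_0, \theta)$ and $\mathcal{D}(\beta_1, \theta)$ are theorems of IPC, then $\mathcal{D}(\theta)$ is a theorem of IPC.
   Context: The Implicational Propositional Calculus (IPC) has formulas built from propositional variables using only $\supset$, the single inference rule modus ponens, and the axiom schemes $X \supset (Y \supset X)$, $[X \supset (Y \supset Z)] \supset [(X \supset Y) \supset (X \supset Z)]$ and $[(X \supset Y) \supset X] \supset X$. For an IPC formula $Z$ write $QZ := Z \supset Q$, so $QQZ = (Z \supset Q)\supset Q$. For a sequence $\theta = (Z_N, \dots, Z_0)$ of IPC formulas, $\mathcal{D}(\theta) := Z_N \supset (Z_{N-1} \supset ( \cdots (Z_0 \supset Q) \cdots ))$, and for a formula $W$, $(W,\theta)$ denotes the sequence $(W, Z_N, \dots, Z_0)$, so $\mathcal{D}(W,\theta) = W \supset \mathcal{D}(\theta)$. *)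

theory Defs
  imports Main
begin

datatype 'a ipc =
    Var 'a
  | Imp "'a ipc" "'a ipc"  (infixr "\<^bold>\<supset>" 55)

inductive ipc_theorem :: "'a ipc \<Rightarrow> bool"  ("\<turnstile> _" [50] 50) where
  ax_K: "\<turnstile> X \<^bold>\<supset> (Y \<^bold>\<supset> X)"
| ax_S: "\<turnstile> (X \<^bold>\<supset> (Y \<^bold>\<supset> Z)) \<^bold>\<supset> ((X \<^bold>\<supset> Y) \<^bold>\<supset> (X \<^bold>\<supset> Z))"
| ax_Peirce: "\<turnstile> ((X \<^bold>\<supset> Y) \<^bold>\<supset> X) \<^bold>\<supset> X"
| modus_ponens: "\<turnstile> X \<Longrightarrow> \<turnstile> X \<^bold>\<supset> Y \<Longrightarrow> \<turnstile> Y"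

text \<open>The formula written \<open>QZ\<close> informally is \<open>qneg Q Z\<close>.\<close>

definition qneg :: "'a ipc \<Rightarrow> 'a ipc \<Rightarrow> 'a ipc" where
  "qneg Q Z = Z \<^bold>\<supset> Q"

text \<open>A sequence \<open>(Z\<^sub>N, \<dots>, Z\<^sub>0)\<close> is the list with head \<open>Z\<^sub>N\<close> and last element \<open>Z\<^sub>0\<close>;
  thus \<open>(W, \<theta>)\<close> is \<open>W # \<theta>\<close>.\<close>

definition seq_formula :: "'a ipc \<Rightarrow> 'a ipc list \<Rightarrow> 'a ipc"  ("\<D>") where
  "\<D> Q \<theta> = foldr (\<^bold>\<supset>) \<theta> Q"

end

theory Submission
  imports Defs
begin

text \<open>
  By the deduction theorem, \<open>\<D> Q \<theta>\<close> is a theorem iff \<open>Q\<close> is derivable from the terms of \<open>\<theta>\<close>.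
  So \<open>QQX\<close> and \<open>QQQY\<close> are derivable from \<open>\<theta>\<close>, and the latter yields \<open>QY\<close>. Under the assumption
  \<open>X \<supset> Y\<close> this gives \<open>QX\<close>, whence \<open>Q\<close> by \<open>QQX\<close>. Discharging the assumption gives \<open>Q(X \<supset> Y)\<close>,
  and then \<open>\<beta> = QQ(X \<supset> Y)\<close> gives \<open>Q\<close>.
\<close>

text \<open>Theorems enter as leaves through \<open>ipc\<close>, so inductions on derivations handle
  all axioms in one case.\<close>

inductive derives :: "'a ipc set \<Rightarrow> 'a ipc \<Rightarrow> bool"  (infix "\<tturnstile>" 50) for \<Gamma> where
  hyp: "X \<in> \<Gamma> \<Longrightarrow> \<Gamma> \<tturnstile> X"
| ipc: "\<turnstile> X \<Longrightarrow> \<Gamma> \<tturnstile> X"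
| mp: "\<Gamma> \<tturnstile> X \<^bold>\<supset> Y \<Longrightarrow> \<Gamma> \<tturnstile> X \<Longrightarrow> \<Gamma> \<tturnstile> Y"

lemma derives_empty_iff: "{} \<tturnstile> X \<longleftrightarrow> \<turnstile> X"
proof
  assume "{} \<tturnstile> X"
  then show "\<turnstile> X"
    by induction (auto intro: modus_ponens)
qed (rule derives.ipc)

lemma derives_mono: "\<Gamma> \<tturnstile> X \<Longrightarrow> \<Gamma> \<subseteq> \<Delta> \<Longrightarrow> \<Delta> \<tturnstile> X"
  by (induction rule: derives.induct) (auto intro: derives.intros)

lemma derives_imp_refl: "\<Gamma> \<tturnstile> X \<^bold>\<supset> X"
proof -
  have "\<turnstile> X \<^bold>\<supset> X"
    \<comment> \<open>The combinator identity S K K = I, read as a proof.\<close>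
    using ax_K[of X X] ax_K[of X "X \<^bold>\<supset> X"] ax_S[of X "X \<^bold>\<supset> X" X] modus_ponens by blast
  then show ?thesis
    by (rule derives.ipc)
qed

text \<open>\<open>ax_K\<close> puts \<open>X\<close> in front of theorems and of the other
  hypotheses; \<open>ax_S\<close> carries the prefix \<open>X\<close> through modus ponens.\<close>

lemma deduction:
  assumes "insert X \<Gamma> \<tturnstile> Y"
  shows "\<Gamma> \<tturnstile> X \<^bold>\<supset> Y"
  using assms
proof induction
  case (hyp Y)
  then show ?case
    by (metis insertE derives_imp_refl derives.hyp derives.ipc derives.mp ax_K)
next
  case (ipc Y)
  then show ?case
    by (metis derives.ipc derives.mp ax_K)
next
  case (mp Y Z)
  then show ?case
    by (metis derives.ipc derives.mp ax_S)
qed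

lemma derives_imp_iff: "\<Gamma> \<tturnstile> X \<^bold>\<supset> Y \<longleftrightarrow> insert X \<Gamma> \<tturnstile> Y"
proof
  assume "\<Gamma> \<tturnstile> X \<^bold>\<supset> Y"
  then have "insert X \<Gamma> \<tturnstile> X \<^bold>\<supset> Y"
    by (rule derives_mono) blast
  then show "insert X \<Gamma> \<tturnstile> Y"
    by (rule derives.mp) (simp add: derives.hyp)
qed (rule deduction)

lemma derives_foldr_imp_iff: "\<Gamma> \<tturnstile> foldr (\<^bold>\<supset>) \<theta> Y \<longleftrightarrow> set \<theta> \<union> \<Gamma> \<tturnstile> Y"
  \<comment> \<open>\<open>\<Gamma>\<close> varies because each term peeled off the list joins the
    hypotheses.\<close>
  by (induction \<theta> arbitrary: \<Gamma>) (simp_all add: derives_imp_iff)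

lemma theorem_seq_formula_iff: "\<turnstile> \<D> Q \<theta> \<longleftrightarrow> set \<theta> \<tturnstile> Q"
  using derives_foldr_imp_iff[of "{}" \<theta> Q] by (simp add: seq_formula_def derives_empty_iff)

lemma derives_imp_trans: "\<Gamma> \<tturnstile> X \<^bold>\<supset> Y \<Longrightarrow> \<Gamma> \<tturnstile> Y \<^bold>\<supset> Z \<Longrightarrow> \<Gamma> \<tturnstile> X \<^bold>\<supset> Z"
  by (metis derives_imp_iff derives_mono derives.mp subset_insertI)

lemma derives_qneg_qneg: "\<Gamma> \<tturnstile> X \<^bold>\<supset> qneg Q (qneg Q X)"
  unfolding qneg_def derives_imp_iff by (rule derives.mp[of _ X]) (simp_all add: derives.hyp)

theorem theorem9:
  fixes Q X Y \<beta> \<beta>\<^sub>0 \<beta>\<^sub>1 :: "'a ipc" and \<theta> :: "'a ipc list"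
  assumes "\<forall>Z \<in> set \<theta>. \<exists>W. Z = qneg Q W \<or> Z = qneg Q (qneg Q W)"
    and "\<beta> = qneg Q (qneg Q (X \<^bold>\<supset> Y))"
    and "\<beta> \<in> set \<theta>"
    and "\<beta>\<^sub>0 = qneg Q X"
    and "\<beta>\<^sub>1 = qneg Q (qneg Q Y)"
    and "\<turnstile> \<D> Q (\<beta>\<^sub>0 # \<theta>)"
    and "\<turnstile> \<D> Q (\<beta>\<^sub>1 # \<theta>)"
  shows "\<turnstile> \<D> Q \<theta>"
proof -
  let ?\<Gamma> = "insert (X \<^bold>\<supset> Y) (set \<theta>)"
  have QQX: "set \<theta> \<tturnstile> qneg Q X \<^bold>\<supset> Q" and QQQY: "set \<theta> \<tturnstile> qneg Q (qneg Q Y) \<^bold>\<supset> Q"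
    using assms(4-7) by (simp_all add: theorem_seq_formula_iff derives_imp_iff)
  have "set \<theta> \<tturnstile> Y \<^bold>\<supset> Q"
    using derives_qneg_qneg QQQY by (rule derives_imp_trans)
  then have "?\<Gamma> \<tturnstile> Y \<^bold>\<supset> Q"
    by (rule derives_mono) blast
  then have "?\<Gamma> \<tturnstile> qneg Q X"
    unfolding qneg_def by (rule derives_imp_trans[rotated]) (simp add: derives.hyp)
  moreover have "?\<Gamma> \<tturnstile> qneg Q X \<^bold>\<supset> Q"
    using QQX by (rule derives_mono) blast
  ultimately have "set \<theta> \<tturnstile> qneg Q (X \<^bold>\<supset> Y)"
    \<comment> \<open>Only the outer \<open>qneg\<close> is unfolded: \<open>qneg Q X\<close> stays
      folded as the minor premise of modus ponens.\<close>
    unfolding qneg_def[of Q "X \<^bold>\<supset> Y"] by (blast intro: deduction derives.mp)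
  moreover have "set \<theta> \<tturnstile> qneg Q (X \<^bold>\<supset> Y) \<^bold>\<supset> Q"
    using assms(2,3) by (simp add: qneg_def derives.hyp)
  ultimately show ?thesis
    by (simp add: theorem_seq_formula_iff derives.mp)
qed

end
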